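(* Let $U\subset\mathbb{R}^n$ be an open bounded set satisfying the cone condition, or $U=\mathbb{R}^n$. For $\alpha\in(0,1)$, $r\in(0,\mathrm{diam}(U))$ and $x\in U$ set \[ W^x_{r,\alpha}=\big\{(w_1,\dots,w_n)\in(\mathbf{B}(0,r))^n\subset(\mathbb{R}^n)^n:\ x+w_i\in U\ \text{for all } i,\ |w_1\wedge\dots\wedge w_n|\ge\alpha r^n\big\}. \] Let $x\in U$. Then there exists $\tilde\alpha\in(0,1)$ such that for all $r\in(0,\mathrm{diam}(U))$ \[ \mathcal{H}^{n^2}(W^x_{r,\tilde\alpha})\ge C r^{n^2}, \] where $C>0$ depends only on $n$ and $U$.
   Context: $\mathbf{B}(0,r)$ is the closed ball of radius $r$ centered at $0$; $\mathrm{diam}(\mathbb{R}^n)=\infty$. For $w_1,\dots,w_n\in\mathbb{R}^n$, $|w_1\wedge\dots\wedge w_n|$ is the $n$-dimensional volume of the parallelotope spanned by $w_1,\dots,w_n$, i.e. $|\det(w_1,\dots,w_n)|$. $\mathcal{H}^{n^2}$ is the Hausdorff (=Lebesgue) measure on $(\mathbb{R}^n)^n$. Cone condition: an open bounded $U\subset\mathbb{R}^n$ satisfies it if there exist bounded open sets $U_1,\dots,U_m$ and cones $C_1,\dots,C_m$, each a rotated copy of a fixed cone $K_h=\{(x',x_n):0<x_n<h,\ |x'|<ax_n\}$, such that $\partial U\subset\bigcup_i U_i$ and $(U\cap U_i)+C_i\subset U$ for each $i$. *)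

theory Defs
  imports "HOL-Analysis.Analysis"
begin

text \<open>The fixed finite cone with vertex 0, axis the unit vector e, height h and
aperture a: in coordinates where e is the last axis this is
K_h = {(x',x_n). 0 < x_n < h, |x'| < a x_n}.\<close>
definition std_cone :: "real \<Rightarrow> real \<Rightarrow> 'a::euclidean_space \<Rightarrow> 'a set" where
  "std_cone a h e = {y. 0 < y \<bullet> e \<and> y \<bullet> e < h \<and> norm (y - (y \<bullet> e) *\<^sub>R e) < a * (y \<bullet> e)}"

definition rotation :: "(real^'n \<Rightarrow> real^'n) \<Rightarrow> bool" where
  "rotation f \<longleftrightarrow> orthogonal_transformation f \<and> det (matrix f) = 1"

text \<open>Cone condition for an open bounded set.\<close>
definition cone_condition :: "(real^'n) set \<Rightarrow> bool" where
  "cone_condition U \<longleftrightarrow> open U \<and> bounded U \<and>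
     (\<exists>a h e. a > 0 \<and> h > 0 \<and> norm e = 1 \<and>
       (\<exists>(m::nat) (V :: nat \<Rightarrow> (real^'n) set) (C :: nat \<Rightarrow> (real^'n) set).
          (\<forall>i<m. open (V i) \<and> bounded (V i) \<and>
                 (\<exists>R. rotation R \<and> C i = R ` std_cone a h e) \<and>
                 {p + c | p c. p \<in> U \<inter> V i \<and> c \<in> C i} \<subseteq> U) \<and>
          frontier U \<subseteq> (\<Union>i<m. V i)))"

text \<open>W^x_{r,alpha}: n-tuples (rows of an n x n matrix) of vectors in the closed
r-ball, with x + w_i in U and |w_1 wedge ... wedge w_n| >= alpha r^n.\<close>
definition Wset :: "(real^'n) set \<Rightarrow> real^'n \<Rightarrow> real \<Rightarrow> real \<Rightarrow> (real^'n^'n) set" where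
  "Wset U x r \<alpha> = {w. (\<forall>i. w $ i \<in> cball 0 r \<and> x + w $ i \<in> U) \<and>
                       \<bar>det w\<bar> \<ge> \<alpha> * r ^ CARD('n)}"

end

theory Submission
  imports Defs
begin

(* Say that x sees S within U (segments_within U x S) if every segment from x to x + y, y in S,
   lies in U except possibly for its endpoint x.  An open S in the ball of radius D contains the
   rows of an invertible matrix N, hence a whole ball of matrices around N whose rows lie in S
   and whose determinants stay above some beta > 0.  If x sees S and r <= D, scaling this ball by r/D puts
   it inside W^x_{r,alpha} for any alpha <= beta/D^n, and its volume is c r^(n^2).  Under the
   cone condition finitely many such S suffice for all x: truncated cones for points covered by
   the V_i, and a small ball for the remaining points, which form a compact subset of U; the
   least of the finitely many constants c is then uniform in x.  For U = UNIV every x sees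
   every S, so r is unrestricted. *)

lemma continuous_on_det: "continuous_on UNIV (det :: real^'n^'n \<Rightarrow> real)"
proof -
  have "continuous_on UNIV (\<lambda>A::real^'n^'n. \<Sum>p | p permutes (UNIV :: 'n set).
      of_int (sign p) * (\<Prod>i\<in>UNIV. A $ i $ p i))"
    by (intro continuous_on_sum continuous_on_mult continuous_on_const continuous_on_prod
          continuous_on_component continuous_on_id)
  then show ?thesis
    unfolding det_def[abs_def] .
qed

lemma det_scaleR: "det (c *\<^sub>R A) = c ^ CARD('n) * det (A :: real^'n^'n)"
proof -
  have "c *\<^sub>R A = (\<chi> i. c *s A $ i)"
    by (simp add: vec_eq_iff)
  then show ?thesis
    using det_rows_mul[of "\<lambda>_. c" "\<lambda>i. A $ i"] by (simp add: vec_lambda_eta)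
qed

lemma exists_invertible_rows_in_open:
  fixes S :: "(real^'n) set"
  assumes "open S" "S \<noteq> {}"
  obtains N :: "real^'n^'n" where "\<And>i. N $ i \<in> S" "det N \<noteq> 0"
proof -
  have "dim S = dim (UNIV :: (real^'n) set)"
    by (rule dim_openin) (use assms in auto)
  then have dim_S: "dim S = CARD('n)"
    by simp
  obtain B where B: "B \<subseteq> S" "independent B" "S \<subseteq> span B" "card B = dim S"
    by (rule basis_exists)
  have "finite B"
    using B(2) by (rule finiteI_independent)
  then have "\<exists>f. bij_betw f (UNIV :: 'n set) B"
    by (intro finite_same_card_bij) (use B(4) dim_S in auto)
  then obtain f :: "'n \<Rightarrow> real^'n" where f: "bij_betw f UNIV B"
    by blast
  define N :: "real^'n^'n" where "N = (\<chi> i. f i)"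
  have "rows N = B"
    using f unfolding rows_def row_def N_def bij_betw_def by (auto simp: vec_lambda_eta)
  then have "rank N = CARD('n)"
    unfolding row_rank_def using dim_eq_card_independent[OF B(2)] B(4) dim_S by simp
  then have "det N \<noteq> 0"
    using det_eq_0_rank[of N] by simp
  moreover have "N $ i \<in> S" for i
    using f B(1) unfolding N_def bij_betw_def by auto
  ultimately show thesis
    by (intro that)
qed

lemma ball_rows_in_open_det_ge:
  fixes S :: "(real^'n) set"
  assumes "open S" "S \<noteq> {}"
  obtains \<delta> \<beta> and N :: "real^'n^'n" where "\<delta> > 0" "\<beta> > 0"
    "\<And>M i. M \<in> ball N \<delta> \<Longrightarrow> M $ i \<in> S" "\<And>M. M \<in> ball N \<delta> \<Longrightarrow> \<beta> \<le> \<bar>det M\<bar>"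
proof -
  obtain N :: "real^'n^'n" where N: "\<And>i. N $ i \<in> S" "det N \<noteq> 0"
    using exists_invertible_rows_in_open[OF assms] by blast
  define \<beta> where "\<beta> = \<bar>det N\<bar> / 2"
  define G where "G = (\<Inter>i. (\<lambda>M::real^'n^'n. M $ i) -` S) \<inter> {M. \<beta> < \<bar>det M\<bar>}"
  have "open G"
    unfolding G_def using \<open>open S\<close>
    by (intro open_Int open_INT open_Collect_less continuous_on_const continuous_on_rabs
        continuous_on_det) (auto intro: open_vimage_vec_nth)
  moreover have "N \<in> G"
    using N by (auto simp: G_def \<beta>_def)
  ultimately obtain \<delta> where \<delta>: "\<delta> > 0" "ball N \<delta> \<subseteq> G"
    using open_contains_ball by blast
  have \<beta>: "\<beta> > 0"
    using N(2) by (simp add: \<beta>_def)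
  have "M $ i \<in> S" "\<beta> \<le> \<bar>det M\<bar>" if "M \<in> ball N \<delta>" for M i
    using \<delta>(2) that unfolding G_def by auto
  then show thesis
    by (rule that[OF \<delta>(1) \<beta>])
qed

lemma sets_lebesgue_Wset:
  fixes U :: "(real^'n) set"
  assumes "open U"
  shows "Wset U x r \<alpha> \<in> sets lebesgue"
proof -
  have Wset_eq: "Wset U x r \<alpha> =
      ((\<Inter>i. (\<lambda>w. w $ i) -` cball 0 r) \<inter> {w. \<alpha> * r ^ CARD('n) \<le> \<bar>det w\<bar>}) \<inter>
      (\<Inter>i. (\<lambda>w. w $ i) -` ((+) x -` U))"
    unfolding Wset_def by auto
  have "closed ((\<Inter>i. (\<lambda>w::real^'n^'n. w $ i) -` cball 0 r) \<inter> {w. \<alpha> * r ^ CARD('n) \<le> \<bar>det w\<bar>})"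
    by (intro closed_Int closed_INT ballI closed_vimage_vec_nth closed_cball closed_Collect_le
        continuous_on_const continuous_on_rabs continuous_on_det)
  moreover have "open ((+) x -` U)"
    using assms by (rule continuous_open_vimage) (intro continuous_intros)
  then have "open (\<Inter>i. (\<lambda>w::real^'n^'n. w $ i) -` ((+) x -` U))"
    by (intro open_INT ballI open_vimage_vec_nth) auto
  ultimately show ?thesis
    unfolding Wset_eq by (intro sets.Int borel_open borel_closed
        sets_completionI_sets[of _ lborel, unfolded sets_lborel])
qed

definition segments_within :: "'a::real_vector set \<Rightarrow> 'a \<Rightarrow> 'a set \<Rightarrow> bool" where
  "segments_within U x S \<longleftrightarrow> (\<forall>y\<in>S. \<forall>t\<in>{0<..1}. x + t *\<^sub>R y \<in> U)"

lemma segments_within_subset: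
  "segments_within U x S \<Longrightarrow> T \<subseteq> S \<Longrightarrow> segments_within U x T"
  unfolding segments_within_def by blast

lemma segments_within_scaleR:
  assumes "segments_within U x S" "0 < s" "s \<le> 1"
  shows "segments_within U x ((*\<^sub>R) s ` S)"
  unfolding segments_within_def
proof (intro ballI)
  fix z t assume "z \<in> (*\<^sub>R) s ` S" "t \<in> {0<..1::real}"
  moreover have "t * s \<in> {0<..1}"
    using \<open>t \<in> {0<..1}\<close> assms(2,3) by (simp add: mult_le_one)
  ultimately show "x + t *\<^sub>R z \<in> U"
    using assms(1) unfolding segments_within_def by auto
qed

lemma segments_within_ball_off_frontier_cover:
  fixes U :: "'a::{real_normed_vector,heine_borel} set"
  assumes "open U" "bounded U" "open W" "frontier U \<subseteq> W"
  obtains \<rho> where "\<rho> > 0" "\<And>x. x \<in> U \<Longrightarrow> x \<notin> W \<Longrightarrow> segments_within U x (ball 0 \<rho>)"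
proof -
  define K where "K = closure U - W"
  have "closed K"
    unfolding K_def using assms(3) by (intro closed_Diff closed_closure)
  moreover have "bounded K"
    unfolding K_def by (rule bounded_subset[OF bounded_closure[OF assms(2)]]) auto
  ultimately have "compact K"
    by (simp add: compact_eq_bounded_closed)
  moreover have "K \<subseteq> U"
    using assms(4) unfolding K_def closure_Un_frontier by auto
  ultimately obtain \<rho> where "\<rho> > 0" and \<rho>: "(\<Union>x\<in>K. ball x \<rho>) \<subseteq> U"
    using compact_subset_open_imp_ball_epsilon_subset[OF _ assms(1)] by blast
  have "x + t *\<^sub>R y \<in> U" if "x \<in> U" "x \<notin> W" "y \<in> ball 0 \<rho>" "t \<in> {0<..1}" for x y t
  proof -
    have "norm (t *\<^sub>R y) \<le> norm y"
      using that(4) by (simp add: mult_left_le_one_le)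
    then have "x + t *\<^sub>R y \<in> ball x \<rho>"
      using that(3) by (simp add: dist_norm)
    moreover have "x \<in> K"
      using that(1,2) closure_subset unfolding K_def by auto
    ultimately show ?thesis
      using \<rho> by blast
  qed
  then show thesis
    using that \<open>\<rho> > 0\<close> unfolding segments_within_def by blast
qed

lemma segments_within_of_cone_translates:
  assumes "{p + c | p c. p \<in> U \<inter> V \<and> c \<in> C} \<subseteq> U" "x \<in> U \<inter> V"
    and "\<And>y t. y \<in> C \<Longrightarrow> 0 < t \<Longrightarrow> t \<le> 1 \<Longrightarrow> t *\<^sub>R y \<in> C"
  shows "segments_within U x C"
  unfolding segments_within_def using assms by fastforce

lemma scaleR_mem_Wset:
  fixes M :: "real^'n^'n"
  assumes rows: "\<And>i. M $ i \<in> S" and S: "S \<subseteq> cball 0 D"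
    and seg: "segments_within U x ((*\<^sub>R) s ` S)" and "0 < s"
    and det: "\<alpha> * D ^ CARD('n) \<le> \<bar>det M\<bar>"
  shows "s *\<^sub>R M \<in> Wset U x (s * D) \<alpha>"
  unfolding Wset_def
proof (intro CollectI conjI allI)
  fix i
  have "M $ i \<in> cball 0 D"
    using rows S by blast
  then have "norm (M $ i) \<le> D"
    by simp
  then show "(s *\<^sub>R M) $ i \<in> cball 0 (s * D)"
    using \<open>0 < s\<close> by (simp add: mult_left_mono)
  have "s *\<^sub>R M $ i \<in> (*\<^sub>R) s ` S"
    using rows by blast
  then have "\<forall>t\<in>{0<..1}. x + t *\<^sub>R (s *\<^sub>R M $ i) \<in> U"
    using seg unfolding segments_within_def by blast
  then have "x + 1 *\<^sub>R (s *\<^sub>R M $ i) \<in> U"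
    by (meson greaterThanAtMost_iff order_refl zero_less_one)
  then show "x + (s *\<^sub>R M) $ i \<in> U"
    by simp
next
  have "\<alpha> * (s * D) ^ CARD('n) = s ^ CARD('n) * (\<alpha> * D ^ CARD('n))"
    by (simp add: power_mult_distrib)
  also have "\<dots> \<le> \<bar>det (s *\<^sub>R M)\<bar>"
    using det \<open>0 < s\<close> by (simp add: det_scaleR abs_mult mult_left_mono)
  finally show "\<alpha> * (s * D) ^ CARD('n) \<le> \<bar>det (s *\<^sub>R M)\<bar>" .
qed

lemma emeasure_Wset_lower_bound:
  fixes S U :: "(real^'n) set"
  assumes "open S" "S \<noteq> {}" "S \<subseteq> cball 0 D" "D > 0" "open U"
  obtains \<alpha> c where "0 < \<alpha>" "\<alpha> < 1" "0 < c"
    "\<And>x r. 0 < r \<Longrightarrow> segments_within U x ((*\<^sub>R) (r / D) ` S) \<Longrightarrow>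
       ennreal (c * r ^ (CARD('n) ^ 2)) \<le> emeasure lebesgue (Wset U x r \<alpha>)"
proof -
  obtain \<delta> \<beta> and N :: "real^'n^'n" where "\<delta> > 0" "\<beta> > 0"
    and N: "\<And>M i. M \<in> ball N \<delta> \<Longrightarrow> M $ i \<in> S" "\<And>M. M \<in> ball N \<delta> \<Longrightarrow> \<beta> \<le> \<bar>det M\<bar>"
    using ball_rows_in_open_det_ge[OF assms(1,2)] by blast
  define \<alpha> where "\<alpha> = min (\<beta> / D ^ CARD('n)) (1/2)"
  define c where "c = unit_ball_vol (CARD('n) ^ 2) * (\<delta> / D) ^ (CARD('n) ^ 2)"
  have "0 < \<alpha>" "\<alpha> < 1"
    using \<open>\<beta> > 0\<close> \<open>D > 0\<close> by (auto simp: \<alpha>_def)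
  have "0 < c"
    unfolding c_def using \<open>\<delta> > 0\<close> \<open>D > 0\<close> by (intro mult_pos_pos unit_ball_vol_pos) auto
  have "\<alpha> \<le> \<beta> / D ^ CARD('n)"
    by (simp add: \<alpha>_def)
  then have "\<alpha> * D ^ CARD('n) \<le> \<beta>"
    using \<open>D > 0\<close> by (simp add: pos_le_divide_eq)
  have bound: "ennreal (c * r ^ (CARD('n) ^ 2)) \<le> emeasure lebesgue (Wset U x r \<alpha>)"
    if "0 < r" and seg: "segments_within U x ((*\<^sub>R) (r / D) ` S)" for x r
  proof -
    define s where "s = r / D"
    have "0 < s" and r_eq: "r = s * D"
      using \<open>0 < r\<close> \<open>D > 0\<close> by (auto simp: s_def)
    have seg_s: "segments_within U x ((*\<^sub>R) s ` S)"
      using seg by (simp only: s_def)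
    have "ball (s *\<^sub>R N) (s * \<delta>) = (*\<^sub>R) s ` ball N \<delta>"
      using ball_scale[of s N \<delta>] \<open>0 < s\<close> by simp
    also have "\<dots> \<subseteq> Wset U x r \<alpha>"
    proof (rule image_subsetI)
      fix M assume "M \<in> ball N \<delta>"
      then have det_M: "\<alpha> * D ^ CARD('n) \<le> \<bar>det M\<bar>"
        using N(2) \<open>\<alpha> * D ^ CARD('n) \<le> \<beta>\<close> by (meson order_trans)
      show "s *\<^sub>R M \<in> Wset U x r \<alpha>"
        unfolding r_eq using N(1)[OF \<open>M \<in> ball N \<delta>\<close>] assms(3) seg_s \<open>0 < s\<close> det_M
        by (rule scaleR_mem_Wset)
    qed
    finally have "emeasure lebesgue (ball (s *\<^sub>R N) (s * \<delta>)) \<le> emeasure lebesgue (Wset U x r \<alpha>)"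
      using sets_lebesgue_Wset[OF assms(5)] by (rule emeasure_mono)
    moreover have "emeasure lebesgue (ball (s *\<^sub>R N) (s * \<delta>)) =
        ennreal (unit_ball_vol (CARD('n) ^ 2) * (s * \<delta>) ^ (CARD('n) ^ 2))"
      using emeasure_ball[of "s * \<delta>" "s *\<^sub>R N"] \<open>0 < s\<close> \<open>\<delta> > 0\<close>
      by (simp add: power2_eq_square)
    moreover have "(s * \<delta>) ^ (CARD('n) ^ 2) = (\<delta> / D) ^ (CARD('n) ^ 2) * r ^ (CARD('n) ^ 2)"
      by (simp add: s_def power_divide power_mult_distrib mult_ac)
    ultimately show ?thesis
      by (simp add: c_def mult.assoc)
  qed
  show thesis
    using that[OF \<open>0 < \<alpha>\<close> \<open>\<alpha> < 1\<close> \<open>0 < c\<close>] bound by blast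
qed

lemma emeasure_Wset_UNIV_lower_bound:
  obtains \<alpha> c where "0 < \<alpha>" "\<alpha> < 1" "0 < c"
    "\<And>(x :: real^'n) r. 0 < r \<Longrightarrow>
       ennreal (c * r ^ (CARD('n) ^ 2)) \<le> emeasure lebesgue (Wset UNIV x r \<alpha>)"
proof -
  have ball: "open (ball (0 :: real^'n) 1)" "ball (0 :: real^'n) 1 \<noteq> {}" "ball (0 :: real^'n) 1 \<subseteq> cball 0 1"
    by auto
  obtain \<alpha> c where "0 < \<alpha>" "\<alpha> < 1" "0 < c" and bound: "\<And>(x :: real^'n) r. 0 < r \<Longrightarrow>
      segments_within UNIV x ((*\<^sub>R) (r / 1) ` ball 0 1) \<Longrightarrow>
      ennreal (c * r ^ (CARD('n) ^ 2)) \<le> emeasure lebesgue (Wset UNIV x r \<alpha>)"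
    using emeasure_Wset_lower_bound[OF ball zero_less_one open_UNIV] by blast
  have "segments_within UNIV x S" for x :: "real^'n" and S
    by (simp add: segments_within_def)
  then show thesis
    using that[OF \<open>0 < \<alpha>\<close> \<open>\<alpha> < 1\<close> \<open>0 < c\<close>] bound by blast
qed

lemma uniform_emeasure_Wset_lower_bound:
  fixes U :: "(real^'n) set"
  assumes "finite \<S>" and \<S>: "\<And>S. S \<in> \<S> \<Longrightarrow> open S \<and> S \<noteq> {} \<and> S \<subseteq> cball 0 D"
    and "D > 0" "open U" and seg: "\<And>x. x \<in> U \<Longrightarrow> \<exists>S\<in>\<S>. segments_within U x S"
  shows "\<exists>C>0. \<forall>x\<in>U. \<exists>\<alpha>. 0 < \<alpha> \<and> \<alpha> < 1 \<and> (\<forall>r. 0 < r \<and> r \<le> D \<longrightarrow>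
           ennreal (C * r ^ (CARD('n) ^ 2)) \<le> emeasure lebesgue (Wset U x r \<alpha>))"
proof -
  define good where "good S \<alpha> c \<longleftrightarrow> 0 < \<alpha> \<and> \<alpha> < 1 \<and> 0 < c \<and>
    (\<forall>x r. 0 < r \<and> r \<le> D \<and> segments_within U x S \<longrightarrow>
       ennreal (c * r ^ (CARD('n) ^ 2)) \<le> emeasure lebesgue (Wset U x r \<alpha>))" for S \<alpha> c
  have "\<exists>\<alpha> c. good S \<alpha> c" if S: "S \<in> \<S>" for S
  proof -
    obtain \<alpha> c where "0 < \<alpha>" "\<alpha> < 1" "0 < c" and bound:
      "\<And>x r. 0 < r \<Longrightarrow> segments_within U x ((*\<^sub>R) (r / D) ` S) \<Longrightarrow>
         ennreal (c * r ^ (CARD('n) ^ 2)) \<le> emeasure lebesgue (Wset U x r \<alpha>)"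
      using emeasure_Wset_lower_bound[of S D U] \<S>[OF S] \<open>D > 0\<close> \<open>open U\<close> by blast
    have "ennreal (c * r ^ (CARD('n) ^ 2)) \<le> emeasure lebesgue (Wset U x r \<alpha>)"
      if "0 < r" "r \<le> D" "segments_within U x S" for x r
      using that \<open>D > 0\<close> by (intro bound segments_within_scaleR) auto
    then show ?thesis
      using \<open>0 < \<alpha>\<close> \<open>\<alpha> < 1\<close> \<open>0 < c\<close> unfolding good_def by blast
  qed
  then obtain \<alpha> c where \<alpha>c: "\<And>S. S \<in> \<S> \<Longrightarrow> good S (\<alpha> S) (c S)"
    by metis
  define C where "C = Min (insert 1 (c ` \<S>))"
  have "0 < C"
    using \<alpha>c \<open>finite \<S>\<close> by (auto simp: C_def good_def)
  moreover have "\<exists>\<alpha>. 0 < \<alpha> \<and> \<alpha> < 1 \<and> (\<forall>r. 0 < r \<and> r \<le> D \<longrightarrow>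
      ennreal (C * r ^ (CARD('n) ^ 2)) \<le> emeasure lebesgue (Wset U x r \<alpha>))" if x: "x \<in> U" for x
  proof -
    obtain S where "S \<in> \<S>" "segments_within U x S"
      using seg[OF x] by blast
    have "C \<le> c S"
      using \<open>S \<in> \<S>\<close> \<open>finite \<S>\<close> by (simp add: C_def)
    then have "ennreal (C * r ^ (CARD('n) ^ 2)) \<le> ennreal (c S * r ^ (CARD('n) ^ 2))" if "0 < r" for r
      using that by (intro ennreal_leI mult_right_mono) auto
    then show ?thesis
      using \<alpha>c[OF \<open>S \<in> \<S>\<close>] \<open>segments_within U x S\<close> unfolding good_def by (meson order_trans)
  qed
  ultimately show ?thesis
    by blast
qed

lemma open_std_cone: "open (std_cone a h e)"
  unfolding std_cone_def by (intro open_Collect_conj open_Collect_less continuous_intros)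

lemma scaleR_mem_std_cone:
  assumes "y \<in> std_cone a h e" "0 < t" "t \<le> 1"
  shows "t *\<^sub>R y \<in> std_cone a h e"
proof -
  have y: "0 < y \<bullet> e" "y \<bullet> e < h" "norm (y - (y \<bullet> e) *\<^sub>R e) < a * (y \<bullet> e)"
    using assms(1) by (auto simp: std_cone_def)
  have "t * (y \<bullet> e) \<le> y \<bullet> e"
    using assms(2,3) y(1) by (simp add: mult_left_le_one_le)
  then have "t * (y \<bullet> e) < h"
    using y(2) by linarith
  moreover have "t *\<^sub>R y - (t * (y \<bullet> e)) *\<^sub>R e = t *\<^sub>R (y - (y \<bullet> e) *\<^sub>R e)"
    by (simp add: algebra_simps)
  moreover have "t * norm (y - (y \<bullet> e) *\<^sub>R e) < a * (t * (y \<bullet> e))"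
    using y(3) assms(2) by (simp add: mult.left_commute)
  ultimately show ?thesis
    using y(1) assms(2) unfolding std_cone_def by auto
qed

lemma scaleR_axis_mem_std_cone:
  assumes "norm e = 1" "0 < a" "0 < t" "t < h"
  shows "t *\<^sub>R e \<in> std_cone a h e"
proof -
  have "e \<bullet> e = 1"
    using assms(1) by (simp add: dot_square_norm)
  then show ?thesis
    using assms(2-4) by (simp add: std_cone_def)
qed

lemma rotated_std_cone:
  fixes R :: "real^'n \<Rightarrow> real^'n"
  assumes "rotation R" "0 < a" "0 < h" "norm e = 1" "0 < D"
  shows "open (R ` std_cone a h e)"
    and "R ` std_cone a h e \<inter> ball 0 D \<noteq> {}"
    and "\<And>y t. y \<in> R ` std_cone a h e \<Longrightarrow> 0 < t \<Longrightarrow> t \<le> 1 \<Longrightarrow> t *\<^sub>R y \<in> R ` std_cone a h e"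
proof -
  have R: "orthogonal_transformation R"
    using assms(1) by (simp add: rotation_def)
  show "open (R ` std_cone a h e)"
    using R by (intro open_surjective_linear_image open_std_cone orthogonal_transformation_linear
        orthogonal_transformation_surj)
  define t0 where "t0 = min h D / 2"
  have "0 < t0" "t0 < h" "t0 < D"
    using assms(3,5) by (auto simp: t0_def)
  then have "R (t0 *\<^sub>R e) \<in> R ` std_cone a h e" "norm (R (t0 *\<^sub>R e)) < D"
    using scaleR_axis_mem_std_cone[OF assms(4,2)] R assms(4) by (auto simp: orthogonal_transformation_norm)
  then show "R ` std_cone a h e \<inter> ball 0 D \<noteq> {}"
    by (auto simp: dist_norm)
  fix y and t :: real assume "y \<in> R ` std_cone a h e" "0 < t" "t \<le> 1"
  then obtain z where "z \<in> std_cone a h e" "y = R z"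
    by blast
  then have "t *\<^sub>R z \<in> std_cone a h e" "t *\<^sub>R y = R (t *\<^sub>R z)"
    using scaleR_mem_std_cone \<open>0 < t\<close> \<open>t \<le> 1\<close> R by (auto simp: orthogonal_transformation_scaleR)
  then show "t *\<^sub>R y \<in> R ` std_cone a h e"
    by simp
qed

lemma cone_condition_segments_family:
  fixes U :: "(real^'n) set"
  assumes "cone_condition U" "D > 0"
  obtains \<S> where "finite \<S>" "\<And>S. S \<in> \<S> \<Longrightarrow> open S \<and> S \<noteq> {} \<and> S \<subseteq> cball 0 D"
    "\<And>x. x \<in> U \<Longrightarrow> \<exists>S\<in>\<S>. segments_within U x S"
proof -
  have "open U" "bounded U"
    using assms(1) by (simp_all add: cone_condition_def)
  obtain a h :: real and e :: "real^'n" and m :: nat and V C :: "nat \<Rightarrow> (real^'n) set"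
    where "a > 0" "h > 0" "norm e = 1"
    and V: "\<forall>i<m. open (V i) \<and> bounded (V i) \<and> (\<exists>R. rotation R \<and> C i = R ` std_cone a h e) \<and>
        {p + c | p c. p \<in> U \<inter> V i \<and> c \<in> C i} \<subseteq> U"
    and frontier: "frontier U \<subseteq> (\<Union>i<m. V i)"
    using assms(1) unfolding cone_condition_def by (elim conjE exE) (rule that)
  have cone: "open (C i)" "C i \<inter> ball 0 D \<noteq> {}"
    "\<And>y t. y \<in> C i \<Longrightarrow> 0 < t \<Longrightarrow> t \<le> 1 \<Longrightarrow> t *\<^sub>R y \<in> C i" if i: "i < m" for i
  proof -
    obtain R where "rotation R" "C i = R ` std_cone a h e"
      using V i by blast
    then show "open (C i)" "C i \<inter> ball 0 D \<noteq> {}"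
      "\<And>y t. y \<in> C i \<Longrightarrow> 0 < t \<Longrightarrow> t \<le> 1 \<Longrightarrow> t *\<^sub>R y \<in> C i"
      using rotated_std_cone[OF _ \<open>a > 0\<close> \<open>h > 0\<close> \<open>norm e = 1\<close> \<open>D > 0\<close>] by auto
  qed
  have "open (\<Union>i<m. V i)"
    using V by (intro open_UN) auto
  then obtain \<rho> where "\<rho> > 0"
    and \<rho>: "\<And>x. x \<in> U \<Longrightarrow> x \<notin> (\<Union>i<m. V i) \<Longrightarrow> segments_within U x (ball 0 \<rho>)"
    using segments_within_ball_off_frontier_cover[OF \<open>open U\<close> \<open>bounded U\<close> _ frontier] by blast
  define \<S> where "\<S> = insert (ball 0 (min \<rho> D)) ((\<lambda>i. C i \<inter> ball 0 D) ` {..<m})"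
  have "open S \<and> S \<noteq> {} \<and> S \<subseteq> cball 0 D" if "S \<in> \<S>" for S
    using that cone(1,2) \<open>\<rho> > 0\<close> \<open>D > 0\<close> unfolding \<S>_def by fastforce
  moreover have "\<exists>S\<in>\<S>. segments_within U x S" if "x \<in> U" for x
  proof (cases "\<exists>i<m. x \<in> V i")
    case True
    then obtain i where "i < m" "x \<in> V i"
      by blast
    then have "segments_within U x (C i)"
      using V \<open>x \<in> U\<close> cone(3) by (intro segments_within_of_cone_translates) auto
    then have "segments_within U x (C i \<inter> ball 0 D)"
      by (rule segments_within_subset) blast
    then show ?thesis
      using \<open>i < m\<close> unfolding \<S>_def by blast
  next
    case False
    then have "segments_within U x (ball 0 (min \<rho> D))"
      using \<open>x \<in> U\<close> by (intro segments_within_subset[OF \<rho>]) auto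
    then show ?thesis
      unfolding \<S>_def by blast
  qed
  moreover have "finite \<S>"
    by (simp add: \<S>_def)
  ultimately show thesis
    using that by blast
qed

theorem lemma4p4:
  fixes U :: "(real^'n) set"
  assumes "cone_condition U \<or> U = UNIV"
  shows "\<exists>C>0. \<forall>x\<in>U. \<exists>\<alpha>. 0 < \<alpha> \<and> \<alpha> < 1 \<and>
           (\<forall>r. 0 < r \<and> (U = UNIV \<or> r < diameter U) \<longrightarrow>
              emeasure lebesgue (Wset U x r \<alpha>) \<ge> ennreal (C * r ^ (CARD('n) ^ 2)))"
proof (cases "U = UNIV")
  case True
  obtain \<alpha> c where "0 < \<alpha>" "\<alpha> < 1" "0 < c" and bound: "\<And>(x :: real^'n) r. 0 < r \<Longrightarrow>
      ennreal (c * r ^ (CARD('n) ^ 2)) \<le> emeasure lebesgue (Wset UNIV x r \<alpha>)"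
    using emeasure_Wset_UNIV_lower_bound by blast
  show ?thesis
    using \<open>0 < \<alpha>\<close> \<open>\<alpha> < 1\<close> \<open>0 < c\<close> bound True by auto
next
  case False
  then have "cone_condition U"
    using assms by blast
  then have "open U"
    by (simp add: cone_condition_def)
  define D where "D = max (diameter U) 1"
  have "D > 0"
    by (simp add: D_def)
  obtain \<S> where "finite \<S>" "\<And>S. S \<in> \<S> \<Longrightarrow> open S \<and> S \<noteq> {} \<and> S \<subseteq> cball 0 D"
    "\<And>x. x \<in> U \<Longrightarrow> \<exists>S\<in>\<S>. segments_within U x S"
    using cone_condition_segments_family[OF \<open>cone_condition U\<close> \<open>D > 0\<close>] by blast
  from uniform_emeasure_Wset_lower_bound[OF this(1,2) \<open>D > 0\<close> \<open>open U\<close> this(3)]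
  obtain C where "C > 0" and C: "\<forall>x\<in>U. \<exists>\<alpha>. 0 < \<alpha> \<and> \<alpha> < 1 \<and> (\<forall>r. 0 < r \<and> r \<le> D \<longrightarrow>
      ennreal (C * r ^ (CARD('n) ^ 2)) \<le> emeasure lebesgue (Wset U x r \<alpha>))"
    by blast
  have "r \<le> D" if "U = UNIV \<or> r < diameter U" for r
    using that False by (simp add: D_def)
  with C have "\<forall>x\<in>U. \<exists>\<alpha>. 0 < \<alpha> \<and> \<alpha> < 1 \<and> (\<forall>r. 0 < r \<and> (U = UNIV \<or> r < diameter U) \<longrightarrow>
      ennreal (C * r ^ (CARD('n) ^ 2)) \<le> emeasure lebesgue (Wset U x r \<alpha>))"
    by metis
  then show ?thesis
    using \<open>C > 0\<close> by auto
qed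

end
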